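(* Let $I\subset\mathbb{R}\setminus\{0\}$ be a real interval, let $f:I\to\mathbb{R}$ be a differentiable function on the interior $I^\circ$ of $I$, and let $a,b\in I$ with $a<b$. If $f'\in L[a,b]$, then for all $x\in[a,b]$ and all $\alpha>0$, $$S_f(g;\alpha;x,a,b)=\frac{(x-a)^{\alpha+1}}{(ax)^{\alpha-1}}\int_0^1\frac{t^\alpha}{(ta+(1-t)x)^2}\,f'\!\left(\frac{ax}{ta+(1-t)x}\right)dt-\frac{(b-x)^{\alpha+1}}{(bx)^{\alpha-1}}\int_0^1\frac{t^\alpha}{(tb+(1-t)x)^2}\,f'\!\left(\frac{bx}{tb+(1-t)x}\right)dt .$$
   Context: Here $g(u)=1/u$ and $$S_f(g;\alpha;x,a,b)=\left[\left(\frac{x-a}{ax}\right)^{\alpha}+\left(\frac{b-x}{bx}\right)^{\alpha}\right]f(x)-\Gamma(\alpha+1)\left\{J_{1/x-}^{\alpha}(f\circ g)(1/b)+J_{1/x+}^{\alpha}(f\circ g)(1/a)\right\},$$ where $\Gamma$ is the Euler Gamma function and the Riemann–Liouville fractional integrals of order $\alpha>0$ are $J_{c+}^{\alpha}h(y)=\frac{1}{\Gamma(\alpha)}\int_c^y(y-t)^{\alpha-1}h(t)\,dt$ for $y>c$ and $J_{d-}^{\alpha}h(y)=\frac{1}{\Gamma(\alpha)}\int_y^d(t-y)^{\alpha-1}h(t)\,dt$ for $y<d$. Explicitly, $J_{1/x-}^{\alpha}(f\circ g)(1/b)=\frac{1}{\Gamma(\alpha)}\int_{1/b}^{1/x}(u-\frac1b)^{\alpha-1}f(\frac1u)\,du$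 and $J_{1/x+}^{\alpha}(f\circ g)(1/a)=\frac{1}{\Gamma(\alpha)}\int_{1/x}^{1/a}(\frac1a-u)^{\alpha-1}f(\frac1u)\,du$; an integral over a degenerate interval (when $x=a$ or $x=b$) is $0$. $L[a,b]$ denotes the integrable functions on $[a,b]$. The derivative $f'$ is regarded as a function on $[a,b]$; if $a$ or $b$ is an endpoint of $I$, $f'$ there is the one-sided derivative. *)

theory Defs
  imports "HOL-Analysis.Analysis"
begin

text \<open>
  Riemann--Liouville fractional integrals of order \<open>\<alpha> > 0\<close>, as Lebesgue integrals over
  \<open>[c, y]\<close> (for \<open>c \<le> y\<close>) and \<open>[y, d]\<close> (for \<open>y \<le> d\<close>); for \<open>y = c\<close>, resp. \<open>y = d\<close>, they are 0.
  At the endpoint \<open>t = y\<close> the convention \<open>0 powr p = 0\<close> affects only a null set.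
\<close>

definition RL_left :: "real \<Rightarrow> real \<Rightarrow> (real \<Rightarrow> real) \<Rightarrow> real \<Rightarrow> real" where
  "RL_left c \<alpha> h y =
     1 / Gamma \<alpha> * (LINT t:{c..y}|lebesgue. (y - t) powr (\<alpha> - 1) * h t)"

definition RL_right :: "real \<Rightarrow> real \<Rightarrow> (real \<Rightarrow> real) \<Rightarrow> real \<Rightarrow> real" where
  "RL_right d \<alpha> h y =
     1 / Gamma \<alpha> * (LINT t:{y..d}|lebesgue. (t - y) powr (\<alpha> - 1) * h t)"

definition S_frac ::
  "(real \<Rightarrow> real) \<Rightarrow> (real \<Rightarrow> real) \<Rightarrow> real \<Rightarrow> real \<Rightarrow> real \<Rightarrow> real \<Rightarrow> real" where
  "S_frac f g \<alpha> x a b =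
     (((x - a) / (a * x)) powr \<alpha> + ((b - x) / (b * x)) powr \<alpha>) * f x
     - Gamma (\<alpha> + 1) *
       (RL_right (1 / x) \<alpha> (f \<circ> g) (1 / b) + RL_left (1 / x) \<alpha> (f \<circ> g) (1 / a))"

end

theory Submission
  imports Defs
begin

text \<open>
  Put \<open>\<phi> t = c x / (t c + (1 - t) x)\<close> for \<open>c \<in> {a, b}\<close>, so that \<open>1 / \<phi>\<close> is affine, \<open>\<phi> 0 = c\<close> and
  \<open>\<phi> 1 = x\<close>. Integrating \<open>t\<^sup>\<alpha> (f \<circ> \<phi>)'(t)\<close> by parts over \<open>[0, 1]\<close> gives
  \<open>f x - \<alpha> \<integral> t\<^sup>\<alpha>\<^sup>-\<^sup>1 f (\<phi> t) dt\<close>, and the affine substitution \<open>u = 1 / \<phi> t\<close> turns the last integral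
  into a multiple of the Riemann--Liouville integral of \<open>f \<circ> g\<close>. The identity is the combination of
  the cases \<open>c = a\<close> and \<open>c = b\<close>. Since \<open>f\<close> is merely differentiable with integrable derivative,
  the fundamental theorem is used for the Henstock--Kurzweil integral.
\<close>

section \<open>Integration by parts against a power weight on the unit interval\<close>

lemma powr_mult_absolutely_integrable:
  fixes F :: "real \<Rightarrow> real"
  assumes "continuous_on {0..1} F" "\<alpha> > 0"
  shows "(\<lambda>t. t powr (\<alpha> - 1) * F t) absolutely_integrable_on {0..1}"
proof -
  \<comment> \<open>For \<alpha> < 1 the weight is unbounded at 0, but its exponent exceeds -1.
    Being nonnegative, it is absolutely integrable, and the continuous factor \<open>F\<close> is
    bounded.\<close>
  have "(\<lambda>t::real. t powr (\<alpha> - 1)) absolutely_integrable_on {0..1}"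
    by (rule nonnegative_absolutely_integrable_1)
       (use assms in \<open>auto intro!: integrable_on_powr_from_0\<close>)
  then have "(\<lambda>t. F t * t powr (\<alpha> - 1)) absolutely_integrable_on {0..1}"
    using assms
    by (intro absolutely_integrable_bounded_measurable_product_real)
       (auto intro!: continuous_imp_measurable_on_sets_lebesgue compact_imp_bounded compact_continuous_image)
  then show ?thesis by (simp add: mult.commute)
qed

text \<open>Fundamental theorem for \<open>t powr \<alpha> * F t\<close>; its value at 0 vanishes
  because \<open>0 powr \<alpha> = 0\<close>.\<close>

lemma powr_integration_by_parts:
  fixes F F' :: "real \<Rightarrow> real"
  assumes cont: "continuous_on {0..1} F"
    and deriv: "\<And>t. t \<in> {0<..<1} \<Longrightarrow> (F has_real_derivative F' t) (at t)"
    and int: "F' absolutely_integrable_on {0..1}"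
    and \<alpha>: "\<alpha> > 0"
  shows "(LINT t:{0..1}|lebesgue. t powr \<alpha> * F' t)
     = F 1 - \<alpha> * (LINT t:{0..1}|lebesgue. t powr (\<alpha> - 1) * F t)"
proof -
  have i1: "(\<lambda>t. t powr (\<alpha> - 1) * F t) absolutely_integrable_on {0..1}"
    using powr_mult_absolutely_integrable[OF cont \<alpha>] .
  have cp: "continuous_on {0..1} (\<lambda>t::real. t powr \<alpha>)"
    by (rule continuous_on_powr') (use \<alpha> in auto)
  have i2: "(\<lambda>t. t powr \<alpha> * F' t) absolutely_integrable_on {0..1}"
    using cp int
    by (intro absolutely_integrable_bounded_measurable_product_real)
       (auto intro!: continuous_imp_measurable_on_sets_lebesgue compact_imp_bounded compact_continuous_image)
  \<comment> \<open>The product rule is applied only on the open interval, since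
    \<open>t powr (\<alpha> - 1)\<close> may blow up at 0; continuity covers the endpoints.
    \<open>F'\<close> need not be continuous, so the integral is the Henstock-Kurzweil one.\<close>
  have "((\<lambda>t. \<alpha> * (t powr (\<alpha> - 1) * F t) + t powr \<alpha> * F' t) has_integral
      (1 powr \<alpha> * F 1 - 0 powr \<alpha> * F 0)) {0..1}"
  proof (rule fundamental_theorem_of_calculus_interior)
    show "continuous_on {0..1} (\<lambda>t. t powr \<alpha> * F t)"
      using cp cont by (rule continuous_on_mult)
    fix t :: real assume t: "t \<in> {0<..<1}"
    have "((\<lambda>t. t powr \<alpha> * F t) has_real_derivative
        \<alpha> * (t powr (\<alpha> - 1) * F t) + t powr \<alpha> * F' t) (at t)"
      using t by (auto intro!: derivative_eq_intros deriv)
    then show "((\<lambda>t. t powr \<alpha> * F t) has_vector_derivative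
        \<alpha> * (t powr (\<alpha> - 1) * F t) + t powr \<alpha> * F' t) (at t)"
      by (simp add: has_real_derivative_iff_has_vector_derivative)
  qed simp
  \<comment> \<open>Absolute integrability of each summand allows the same integral to be split, and
    later to be read as Lebesgue integrals.\<close>
  moreover have "((\<lambda>t. \<alpha> * (t powr (\<alpha> - 1) * F t) + t powr \<alpha> * F' t) has_integral
      (\<alpha> * integral {0..1} (\<lambda>t. t powr (\<alpha> - 1) * F t) + integral {0..1} (\<lambda>t. t powr \<alpha> * F' t))) {0..1}"
    using i1 i2
    by (intro has_integral_add has_integral_mult_right integrable_integral)
       (auto dest: set_lebesgue_integral_eq_integral(1))
  ultimately have "1 powr \<alpha> * F 1 - 0 powr \<alpha> * F 0 = \<alpha> * integral {0..1} (\<lambda>t. t powr (\<alpha> - 1) * F t) + integral {0..1} (\<lambda>t. t powr \<alpha> * F' t)"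
    by (rule has_integral_unique)
  then show ?thesis
    using set_lebesgue_integral_eq_integral(2)[OF i1] set_lebesgue_integral_eq_integral(2)[OF i2]
    by simp
qed

section \<open>Riemann-Liouville integrals as weighted integrals over the unit interval\<close>

lemma set_lebesgue_integral_affine_unit:
  fixes h :: "real \<Rightarrow> real"
  assumes "p \<noteq> q"
    and "(\<lambda>s. h (p + (q - p) * s)) absolutely_integrable_on {0..1}"
  shows "(LINT u:closed_segment p q|lebesgue. h u)
     = \<bar>q - p\<bar> * (LINT s:{0..1}|lebesgue. h (p + (q - p) * s))"
proof -
  let ?g = "\<lambda>s. p + (q - p) * s"
  \<comment> \<open>A segment covers both orientations: the left integral runs from \<open>y\<close>
    down to \<open>c\<close>, the right one from \<open>y\<close> up to \<open>d\<close>. Hence the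
    Jacobian \<open>\<bar>q - p\<bar>\<close>.\<close>
  have img: "?g ` {0..1} = closed_segment p q"
    by (auto simp: closed_segment_def image_def algebra_simps)
  have i: "(\<lambda>s. \<bar>q - p\<bar> * h (?g s)) absolutely_integrable_on {0..1}"
    using assms(2) by (simp add: set_integrable_mult_right)
  have "h absolutely_integrable_on ?g ` {0..1} \<and>
      integral (?g ` {0..1}) h = integral {0..1} (\<lambda>s. \<bar>q - p\<bar> * h (?g s))"
  proof (rule iffD1[OF has_absolute_integral_change_of_variables_1'])
    show "inj_on ?g {0..1}"
      using assms(1) by (auto intro!: inj_onI)
    show "(?g has_real_derivative q - p) (at s within {0..1})" for s
      by (auto intro!: derivative_eq_intros)
  qed (use i in auto)
  then show ?thesis
    using assms(2) by (simp add: img set_lebesgue_integral_eq_integral(2))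
qed

lemma Gamma_plus1_pos:
  fixes \<alpha> :: real
  assumes "\<alpha> > 0"
  shows "Gamma (\<alpha> + 1) = \<alpha> * Gamma \<alpha>"
  using assms nonpos_Ints_nonpos[of \<alpha>] by (intro Gamma_plus1) auto

text \<open>The substitution starts at the singular endpoint \<open>y\<close>, so the kernel becomes
  a constant times \<open>s powr (\<alpha> - 1)\<close>. This constant and the Jacobian combine to
  \<open>(y - c) powr \<alpha>\<close>, and the quotient of the Gamma values is \<alpha>.\<close>

lemma RL_left_eq_unit_integral:
  assumes "c < y" "\<alpha> > 0"
    and "continuous_on {0..1} (\<lambda>s. h (y + (c - y) * s))"
  shows "Gamma (\<alpha> + 1) * RL_left c \<alpha> h y
     = (y - c) powr \<alpha> * (\<alpha> * (LINT s:{0..1}|lebesgue. s powr (\<alpha> - 1) * h (y + (c - y) * s)))"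
proof -
  let ?k = "\<lambda>s. s powr (\<alpha> - 1) * h (y + (c - y) * s)"
  let ?H = "\<lambda>u. (y - u) powr (\<alpha> - 1) * h u"
  \<comment> \<open>The indicator restricts to s \<ge> 0, where the power of the product
    \<open>(y - c) * s\<close> splits. As an equality of functions it rewrites both the
    integrability claim and the integral.\<close>
  have eq: "(\<lambda>s. indicator {0..1} s *\<^sub>R ?H (y + (c - y) * s))
      = (\<lambda>s. indicator {0..1} s *\<^sub>R ((y - c) powr (\<alpha> - 1) * ?k s))"
  proof
    fix s :: real
    have "y - (y + (c - y) * s) = (y - c) * s" by (simp add: algebra_simps)
    then show "indicator {0..1} s *\<^sub>R ?H (y + (c - y) * s)
        = indicator {0..1} s *\<^sub>R ((y - c) powr (\<alpha> - 1) * ?k s)"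
      using assms(1) by (auto simp: powr_mult indicator_def)
  qed
  have "(\<lambda>s. (y - c) powr (\<alpha> - 1) * ?k s) absolutely_integrable_on {0..1}"
    using powr_mult_absolutely_integrable[OF assms(3,2)] by (simp add: set_integrable_mult_right)
  then have "(\<lambda>s. ?H (y + (c - y) * s)) absolutely_integrable_on {0..1}"
    unfolding set_integrable_def eq .
  from set_lebesgue_integral_affine_unit[OF _ this] assms(1)
  have "(LINT u:{c..y}|lebesgue. ?H u)
      = (y - c) * (LINT s:{0..1}|lebesgue. ?H (y + (c - y) * s))"
    by (simp add: closed_segment_eq_real_ivl)
  also have "\<dots> = (y - c) * ((y - c) powr (\<alpha> - 1) * (LINT s:{0..1}|lebesgue. ?k s))"
    by (subst set_integral_mult_right[symmetric]) (simp only: set_lebesgue_integral_def eq)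
  also have "\<dots> = (y - c) powr \<alpha> * (LINT s:{0..1}|lebesgue. ?k s)"
    using assms(1) by (simp add: powr_mult_base)
  finally show ?thesis
    using Gamma_plus1_pos[OF assms(2)] Gamma_real_pos[OF assms(2)]
    by (simp add: RL_left_def)
qed

lemma RL_right_eq_unit_integral:
  assumes "y < d" "\<alpha> > 0"
    and "continuous_on {0..1} (\<lambda>s. h (y + (d - y) * s))"
  shows "Gamma (\<alpha> + 1) * RL_right d \<alpha> h y
     = (d - y) powr \<alpha> * (\<alpha> * (LINT s:{0..1}|lebesgue. s powr (\<alpha> - 1) * h (y + (d - y) * s)))"
proof -
  let ?k = "\<lambda>s. s powr (\<alpha> - 1) * h (y + (d - y) * s)"
  let ?H = "\<lambda>u. (u - y) powr (\<alpha> - 1) * h u"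
  have eq: "(\<lambda>s. indicator {0..1} s *\<^sub>R ?H (y + (d - y) * s))
      = (\<lambda>s. indicator {0..1} s *\<^sub>R ((d - y) powr (\<alpha> - 1) * ?k s))"
    using assms(1) by (auto simp: powr_mult indicator_def fun_eq_iff)
  have "(\<lambda>s. (d - y) powr (\<alpha> - 1) * ?k s) absolutely_integrable_on {0..1}"
    using powr_mult_absolutely_integrable[OF assms(3,2)] by (simp add: set_integrable_mult_right)
  then have "(\<lambda>s. ?H (y + (d - y) * s)) absolutely_integrable_on {0..1}"
    unfolding set_integrable_def eq .
  from set_lebesgue_integral_affine_unit[OF _ this] assms(1)
  have "(LINT u:{y..d}|lebesgue. ?H u)
      = (d - y) * (LINT s:{0..1}|lebesgue. ?H (y + (d - y) * s))"
    by (simp add: closed_segment_eq_real_ivl)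
  also have "\<dots> = (d - y) * ((d - y) powr (\<alpha> - 1) * (LINT s:{0..1}|lebesgue. ?k s))"
    by (subst set_integral_mult_right[symmetric]) (simp only: set_lebesgue_integral_def eq)
  also have "\<dots> = (d - y) powr \<alpha> * (LINT s:{0..1}|lebesgue. ?k s)"
    using assms(1) by (simp add: powr_mult_base)
  finally show ?thesis
    using Gamma_plus1_pos[OF assms(2)] Gamma_real_pos[OF assms(2)]
    by (simp add: RL_right_def)
qed

section \<open>Harmonic interpolation: the path with reciprocal
  \<open>(1 - t) / c + t / x\<close>\<close>

definition harm_path :: "real \<Rightarrow> real \<Rightarrow> real \<Rightarrow> real" where
  "harm_path c x t = c * x / (t * c + (1 - t) * x)"

text \<open>Multiplying by \<open>c\<close> treats positive and negative intervals alike: the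
  product is a combination of \<open>c\<^sup>2\<close> and \<open>c * x\<close>, both
  positive.\<close>

lemma same_sign_convex_comb:
  fixes c x t :: real
  assumes "c * x > 0" "t \<in> {0..1}"
  shows "c * (t * c + (1 - t) * x) > 0"
proof -
  have "c * (t * c + (1 - t) * x) = t * c\<^sup>2 + (1 - t) * (c * x)"
    by (simp add: algebra_simps power2_eq_square)
  moreover have "\<dots> > 0"
  proof (cases "t = 1")
    case True
    with assms show ?thesis by auto
  next
    case False
    with assms have "(1 - t) * (c * x) > 0" by (intro mult_pos_pos[of "1 - t"]) auto
    moreover have "t * c\<^sup>2 \<ge> 0" using assms by simp
    ultimately show ?thesis by linarith
  qed
  ultimately show ?thesis by simp
qed

lemma same_sign_convex_comb_nonzero:
  fixes c x t :: real
  assumes "c * x > 0" "t \<in> {0..1}"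
  shows "t * c + (1 - t) * x \<noteq> 0"
  using same_sign_convex_comb[OF assms] by auto

text \<open>Identifies \<open>f\<close> along the path with \<open>f \<circ> g\<close> along the
  affine parametrization from \<open>1 / c\<close> to \<open>1 / x\<close>, which is what the
  Riemann-Liouville integrals produce.\<close>

lemma harm_path_eq_inverse_affine:
  assumes "c * x > 0" "t \<in> {0..1}"
  shows "harm_path c x t = 1 / (1 / c + (1 / x - 1 / c) * t)"
proof -
  have "c \<noteq> 0" "x \<noteq> 0" using assms(1) by auto
  then have "1 / c + (1 / x - 1 / c) * t = (t * c + (1 - t) * x) / (c * x)"
    by (simp add: field_simps)
  then show ?thesis by (simp add: harm_path_def)
qed

lemma harm_path_has_real_derivative:
  assumes "c * x > 0" "t \<in> {0..1}"
  shows "(harm_path c x has_real_derivative c * x * (x - c) / (t * c + (1 - t) * x)\<^sup>2) (at t within S)"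
  using same_sign_convex_comb_nonzero[OF assms] unfolding harm_path_def
  by (auto intro!: derivative_eq_intros simp: power2_eq_square algebra_simps)

lemma inj_on_harm_path:
  assumes "c * x > 0" "c \<noteq> x"
  shows "inj_on (harm_path c x) {0..1}"
proof (rule inj_onI)
  fix s t assume s: "s \<in> {0..1}" and t: "t \<in> {0..1}" and "harm_path c x s = harm_path c x t"
  moreover have "c * x \<noteq> 0" using assms(1) by auto
  ultimately have "s * c + (1 - s) * x = t * c + (1 - t) * x"
    by (simp add: harm_path_def)
  then have "(s - t) * (c - x) = 0" by (simp add: algebra_simps)
  then show "s = t" using assms(2) by simp
qed

lemma harm_path_eq_convex_comb:
  assumes "c * x > 0" "t \<in> {0..1}"
  obtains l where "harm_path c x t = (1 - l) *\<^sub>R c + l *\<^sub>R x"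
    and "0 \<le> l" "l \<le> 1" "t \<in> {0<..<1} \<Longrightarrow> 0 < l \<and> l < 1"
proof -
  define D where "D = t * c + (1 - t) * x"
  \<comment> \<open>Read off from the numerator:
    \<open>c * x = ((1 - t) * x) * c + (t * c) * x\<close>, so the weights of \<open>c\<close> and
    \<open>x\<close> are these coefficients over \<open>D\<close>.\<close>
  define l where "l = t * c / D"
  have nz: "D \<noteq> 0"
    using same_sign_convex_comb_nonzero[OF assms] by (simp add: D_def)
  have pos: "c * D > 0"
    using same_sign_convex_comb[OF assms] by (simp add: D_def)
  have c: "c \<noteq> 0" using assms(1) by auto
  have "(1 - l) * c + l * x = (D * c - t * c * c + t * c * x) / D"
    using nz by (simp add: l_def field_simps)
  also have "D * c - t * c * c + t * c * x = c * x"
    by (simp add: D_def algebra_simps)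
  finally have 1: "harm_path c x t = (1 - l) *\<^sub>R c + l *\<^sub>R x"
    by (simp add: harm_path_def D_def)
  \<comment> \<open>Expanding both weights by \<open>c\<close> gives fractions whose numerators and
    denominators have known signs, whatever the sign of \<open>c\<close>.\<close>
  have l: "l = t * c\<^sup>2 / (c * D)"
    using c nz by (simp add: l_def power2_eq_square)
  have "1 - l = (D - t * c) / D"
    using nz by (simp add: l_def diff_divide_distrib)
  also have "\<dots> = (1 - t) * (c * x) / (c * D)"
    using c by (simp add: D_def)
  finally have l': "1 - l = (1 - t) * (c * x) / (c * D)" .
  have "0 \<le> l"
    unfolding l using pos assms(2) by (intro divide_nonneg_pos mult_nonneg_nonneg) auto
  moreover have "0 \<le> 1 - l"
    unfolding l' using pos assms by (intro divide_nonneg_pos mult_nonneg_nonneg[of "1 - t"]) auto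
  moreover have "0 < l" if "t \<in> {0<..<1}"
    unfolding l using pos that c by (intro divide_pos_pos mult_pos_pos[of t]) auto
  moreover have "0 < 1 - l" if "t \<in> {0<..<1}"
    unfolding l' using pos assms that by (intro divide_pos_pos mult_pos_pos[of "1 - t"]) auto
  ultimately show thesis using that[OF 1] by simp
qed

lemma harm_path_in_closed_segment:
  assumes "c * x > 0" "t \<in> {0..1}"
  shows "harm_path c x t \<in> closed_segment c x"
  unfolding in_segment by (rule harm_path_eq_convex_comb[OF assms]) blast

lemma harm_path_in_open_segment:
  assumes "c * x > 0" "c \<noteq> x" "t \<in> {0<..<1}"
  shows "harm_path c x t \<in> open_segment c x"
proof -
  have "t \<in> {0..1}" using assms(3) by auto
  from harm_path_eq_convex_comb[OF assms(1) this] assms(2,3) show ?thesis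
    unfolding in_segment by metis
qed

text \<open>Integration by parts for \<open>F = f \<circ> harm_path c x\<close>. The change of
  variables serves only to transfer integrability of \<open>f'\<close> to the derivative of
  \<open>F\<close>.\<close>

lemma harm_path_integral_by_parts:
  assumes cx: "c * x > 0" "c \<noteq> x" and \<alpha>: "\<alpha> > 0"
    and cont: "continuous_on (closed_segment c x) f"
    and deriv: "\<And>u. u \<in> open_segment c x \<Longrightarrow> (f has_real_derivative f' u) (at u)"
    and int: "f' absolutely_integrable_on closed_segment c x"
  shows "c * x * (x - c) *
      (LINT t:{0..1}|lebesgue. t powr \<alpha> / (t * c + (1 - t) * x)\<^sup>2 * f' (harm_path c x t))
     = f x - \<alpha> * (LINT t:{0..1}|lebesgue. t powr (\<alpha> - 1) * f (harm_path c x t))"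
proof -
  let ?\<phi> = "harm_path c x"
  let ?d = "\<lambda>t. c * x * (x - c) / (t * c + (1 - t) * x)\<^sup>2"
  have \<phi>cont: "continuous_on {0..1} ?\<phi>"
    by (rule DERIV_continuous_on) (rule harm_path_has_real_derivative[OF cx(1)])
  have img: "?\<phi> ` {0..1} \<subseteq> closed_segment c x"
    using harm_path_in_closed_segment[OF cx(1)] by auto
  have "f' absolutely_integrable_on ?\<phi> ` {0..1}"
  proof (rule set_integrable_subset[OF int _ img])
    show "?\<phi> ` {0..1} \<in> sets lebesgue"
      using compact_continuous_image[OF \<phi>cont] by (simp add: compact_imp_closed)
  qed
  then have abs: "(\<lambda>t. \<bar>?d t\<bar> *\<^sub>R f' (?\<phi> t)) absolutely_integrable_on {0..1}"
    by (subst (asm) absolutely_integrable_change_of_variables_real[where h = ?d])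
       (use harm_path_has_real_derivative[OF cx(1)] inj_on_harm_path[OF cx] in auto)
  \<comment> \<open>The change of variables yields \<open>\<bar>?d t\<bar>\<close>, while the chain
    rule needs \<open>?d t\<close>. Its sign is constant along the path, so a constant factor
    repairs this.\<close>
  have "sgn (x - c) * \<bar>?d t\<bar> = ?d t" for t
  proof -
    have "\<bar>?d t\<bar> = c * x * \<bar>x - c\<bar> / (t * c + (1 - t) * x)\<^sup>2"
      using cx(1) by (simp only: abs_divide abs_mult[of "c * x"] abs_of_pos abs_power2)
    then have "sgn (x - c) * \<bar>?d t\<bar> = c * x * (sgn (x - c) * \<bar>x - c\<bar>) / (t * c + (1 - t) * x)\<^sup>2"
      by (metis mult.left_commute times_divide_eq_right)
    then show ?thesis by (simp only: mult_sgn_abs)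
  qed
  then have eq: "(\<lambda>t. sgn (x - c) * (\<bar>?d t\<bar> *\<^sub>R f' (?\<phi> t))) = (\<lambda>t. f' (?\<phi> t) * ?d t)"
    by (simp only: fun_eq_iff real_scaleR_def mult.assoc[symmetric]) (simp add: mult.commute)
  have int': "(\<lambda>t. f' (?\<phi> t) * ?d t) absolutely_integrable_on {0..1}"
    unfolding eq[symmetric] by (rule set_integrable_mult_right) (rule abs)
  have parts: "(LINT t:{0..1}|lebesgue. t powr \<alpha> * (f' (?\<phi> t) * ?d t))
      = f (?\<phi> 1) - \<alpha> * (LINT t:{0..1}|lebesgue. t powr (\<alpha> - 1) * f (?\<phi> t))"
  proof (rule powr_integration_by_parts[OF _ _ int' \<alpha>])
    show "continuous_on {0..1} (\<lambda>t. f (?\<phi> t))"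
      by (rule continuous_on_compose2[OF cont \<phi>cont img])
    show "((\<lambda>t. f (?\<phi> t)) has_real_derivative f' (?\<phi> t) * ?d t) (at t)" if "t \<in> {0<..<1}" for t
      by (rule DERIV_chain2[OF deriv[OF harm_path_in_open_segment[OF cx that]]
            harm_path_has_real_derivative[OF cx(1)]]) (use that in auto)
  qed
  have \<phi>1: "?\<phi> 1 = x"
    using cx(1) by (auto simp: harm_path_def)
  have fac: "(\<lambda>t. t powr \<alpha> * (f' (?\<phi> t) * ?d t))
      = (\<lambda>t. c * x * (x - c) * (t powr \<alpha> / (t * c + (1 - t) * x)\<^sup>2 * f' (?\<phi> t)))"
    by (simp add: fun_eq_iff)
  show ?thesis
    using parts unfolding fac \<phi>1 set_integral_mult_right .
qed

section \<open>The identity for a single endpoint\<close>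

lemma unit_integral_harm_path_cong:
  assumes "c * x > 0"
  shows "(LINT s:{0..1}|lebesgue. s powr p * ((f \<circ> (\<lambda>u. 1 / u)) (1 / c + (1 / x - 1 / c) * s)))
     = (LINT s:{0..1}|lebesgue. s powr p * f (harm_path c x s))"
proof (rule set_lebesgue_integral_cong, goal_cases)
  case 1
  then show ?case by simp
next
  case 2
  then show ?case
    using harm_path_eq_inverse_affine[OF assms] by (metis comp_apply)
qed

lemma continuous_on_harm_path_affine:
  fixes f :: "real \<Rightarrow> real"
  assumes "c * x > 0" "continuous_on (closed_segment c x) f"
  shows "continuous_on {0..1} (\<lambda>s. (f \<circ> (\<lambda>u. 1 / u)) (1 / c + (1 / x - 1 / c) * s))"
proof -
  have "continuous_on {0..1} (harm_path c x)"
    by (rule DERIV_continuous_on) (rule harm_path_has_real_derivative[OF assms(1)])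
  then have "continuous_on {0..1} (\<lambda>s. f (harm_path c x s))"
    by (rule continuous_on_compose2[OF assms(2)]) (use harm_path_in_closed_segment[OF assms(1)] in auto)
  then show ?thesis
    by (rule continuous_on_eq) (simp only: harm_path_eq_inverse_affine[OF assms(1)] o_apply)
qed

text \<open>With \<open>k = c * x\<close> and \<open>d\<close> the distance from \<open>c\<close> to
  \<open>x\<close>, this turns the factors from the substitution and from integration by parts into
  the stated prefactor.\<close>

lemma same_sign_prefactor:
  fixes k d :: real
  assumes "k > 0" "d > 0"
  shows "(d / k) powr \<alpha> * (k * d) = d powr (\<alpha> + 1) / k powr (\<alpha> - 1)"
  using assms by (simp add: powr_divide powr_add powr_diff)

text \<open>At the single point t = y the kernel is \<open>0 powr (\<alpha> - 1) = 0\<close>, so the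
  integrand vanishes everywhere. This covers \<open>x\<close> at an endpoint.\<close>

lemma RL_left_self [simp]: "RL_left y \<alpha> h y = 0"
proof -
  have "(\<lambda>t. indicator {y} t *\<^sub>R ((y - t) powr (\<alpha> - 1) * h t)) = (\<lambda>_. 0)"
    by (auto simp: indicator_def fun_eq_iff)
  then show ?thesis by (simp add: RL_left_def set_lebesgue_integral_def)
qed

lemma RL_right_self [simp]: "RL_right y \<alpha> h y = 0"
proof -
  have "(\<lambda>t. indicator {y} t *\<^sub>R ((t - y) powr (\<alpha> - 1) * h t)) = (\<lambda>_. 0)"
    by (auto simp: indicator_def fun_eq_iff)
  then show ?thesis by (simp add: RL_right_def set_lebesgue_integral_def)
qed

text \<open>The case c = a: the identity from integration by parts, multiplied by the power of
  \<open>1 / c - 1 / x = (x - c) / (c * x)\<close>. For c = x every term is 0.\<close>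

lemma RL_left_harm_path:
  assumes cx: "c * x > 0" "c \<le> x" and \<alpha>: "\<alpha> > 0"
    and cont: "continuous_on (closed_segment c x) f"
    and deriv: "\<And>u. u \<in> open_segment c x \<Longrightarrow> (f has_real_derivative f' u) (at u)"
    and int: "f' absolutely_integrable_on closed_segment c x"
  shows "((x - c) / (c * x)) powr \<alpha> * f x - Gamma (\<alpha> + 1) * RL_left (1 / x) \<alpha> (f \<circ> (\<lambda>u. 1 / u)) (1 / c)
     = (x - c) powr (\<alpha> + 1) / (c * x) powr (\<alpha> - 1) *
       (LINT t:{0..1}|lebesgue. t powr \<alpha> / (t * c + (1 - t) * x)\<^sup>2 * f' (harm_path c x t))"
proof (cases "c = x")
  case True
  then show ?thesis by simp
next
  case False
  have d: "1 / c - 1 / x = (x - c) / (c * x)"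
    using cx(1) by (auto simp: diff_divide_distrib)
  have "(x - c) / (c * x) > 0" using cx False by simp
  then have lt: "1 / x < 1 / c" using d by linarith
  have RL: "Gamma (\<alpha> + 1) * RL_left (1 / x) \<alpha> (f \<circ> (\<lambda>u. 1 / u)) (1 / c)
      = ((x - c) / (c * x)) powr \<alpha> * (\<alpha> * (LINT t:{0..1}|lebesgue. t powr (\<alpha> - 1) * f (harm_path c x t)))"
    using RL_left_eq_unit_integral[OF lt \<alpha> continuous_on_harm_path_affine[OF cx(1) cont]]
    unfolding d[symmetric] unit_integral_harm_path_cong[OF cx(1)] .
  have pre: "((x - c) / (c * x)) powr \<alpha> * (c * x * (x - c)) = (x - c) powr (\<alpha> + 1) / (c * x) powr (\<alpha> - 1)"
    using same_sign_prefactor[of "c * x" "x - c" \<alpha>] cx False by simp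
  \<comment> \<open>The remaining algebra with the integrals kept opaque:
    \<open>K * N = v - M\<close> is integration by parts, \<open>W * K = P\<close> the prefactor
    identity.\<close>
  have "W * v - W * M = P * N" if "K * N = v - M" "W * K = P" for W v M P N K :: real
    by (metis that mult.assoc right_diff_distrib)
  from this[OF harm_path_integral_by_parts[OF cx(1) False \<alpha> cont deriv int] pre] show ?thesis
    by (simp only: RL)
qed

text \<open>The case c = b. Here the path descends, so the factor \<open>c * x * (x - c)\<close> is
  negative; this is the origin of the minus sign in the final formula.\<close>

lemma RL_right_harm_path:
  assumes cx: "c * x > 0" "x \<le> c" and \<alpha>: "\<alpha> > 0"
    and cont: "continuous_on (closed_segment c x) f"
    and deriv: "\<And>u. u \<in> open_segment c x \<Longrightarrow> (f has_real_derivative f' u) (at u)"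
    and int: "f' absolutely_integrable_on closed_segment c x"
  shows "((c - x) / (c * x)) powr \<alpha> * f x - Gamma (\<alpha> + 1) * RL_right (1 / x) \<alpha> (f \<circ> (\<lambda>u. 1 / u)) (1 / c)
     = - ((c - x) powr (\<alpha> + 1) / (c * x) powr (\<alpha> - 1) *
       (LINT t:{0..1}|lebesgue. t powr \<alpha> / (t * c + (1 - t) * x)\<^sup>2 * f' (harm_path c x t)))"
proof (cases "c = x")
  case True
  then show ?thesis by simp
next
  case False
  have d: "1 / x - 1 / c = (c - x) / (c * x)"
    using cx(1) by (auto simp: diff_divide_distrib)
  have "(c - x) / (c * x) > 0" using cx False by simp
  then have lt: "1 / c < 1 / x" using d by linarith
  have RL: "Gamma (\<alpha> + 1) * RL_right (1 / x) \<alpha> (f \<circ> (\<lambda>u. 1 / u)) (1 / c)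
      = ((c - x) / (c * x)) powr \<alpha> * (\<alpha> * (LINT t:{0..1}|lebesgue. t powr (\<alpha> - 1) * f (harm_path c x t)))"
    using RL_right_eq_unit_integral[OF lt \<alpha> continuous_on_harm_path_affine[OF cx(1) cont]]
    unfolding d[symmetric] unit_integral_harm_path_cong[OF cx(1)] .
  have pre: "((c - x) / (c * x)) powr \<alpha> * (c * x * (x - c)) = - ((c - x) powr (\<alpha> + 1) / (c * x) powr (\<alpha> - 1))"
    using same_sign_prefactor[of "c * x" "c - x" \<alpha>] cx False by (simp add: algebra_simps)
  have "W * v - W * M = P * N" if "K * N = v - M" "W * K = P" for W v M P N K :: real
    by (metis that mult.assoc right_diff_distrib)
  from this[OF harm_path_integral_by_parts[OF cx(1) False \<alpha> cont deriv int] pre] show ?thesis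
    by (simp only: RL mult_minus_left)
qed

section \<open>Combination of the endpoints \<open>a\<close> and \<open>b\<close>\<close>

theorem lemma2:
  fixes I :: "real set" and f f' :: "real \<Rightarrow> real" and a b :: real
  assumes "is_interval I" and "0 \<notin> I"
    and "f differentiable_on interior I"
    and "a \<in> I" and "b \<in> I" and "a < b"
    and "\<And>u. u \<in> {a..b} \<Longrightarrow> (f has_real_derivative f' u) (at u within I)"
    and "set_integrable lebesgue {a..b} f'"
  shows "\<forall>x\<in>{a..b}. \<forall>\<alpha>>0.
    S_frac f (\<lambda>u. 1 / u) \<alpha> x a b =
      (x - a) powr (\<alpha> + 1) / (a * x) powr (\<alpha> - 1) *
        (LINT t:{0..1}|lebesgue.
           t powr \<alpha> / (t * a + (1 - t) * x)\<^sup>2 * f' (a * x / (t * a + (1 - t) * x)))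
      - (b - x) powr (\<alpha> + 1) / (b * x) powr (\<alpha> - 1) *
        (LINT t:{0..1}|lebesgue.
           t powr \<alpha> / (t * b + (1 - t) * x)\<^sup>2 * f' (b * x / (t * b + (1 - t) * x)))"
proof (intro ballI allI impI)
  fix x \<alpha> :: real assume x: "x \<in> {a..b}" and \<alpha>: "\<alpha> > 0"
  have sub: "{a..b} \<subseteq> I"
    using mem_is_interval_1_I[OF assms(1,4,5)] by auto
  then have "0 \<notin> {a..b}" using assms(2) by auto
  \<comment> \<open>An interval avoiding 0 lies on one side of it, so \<open>a\<close>,
    \<open>b\<close> and \<open>x\<close> share a sign.\<close>
  then have pos: "a * x > 0" "b * x > 0"
    using x by (auto simp: zero_less_mult_iff)
  have seg: "closed_segment c x \<subseteq> {a..b}" "open_segment c x \<subseteq> {a<..<b}" if "c \<in> {a, b}" for c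
    using x that assms(6) by (auto simp: closed_segment_eq_real_ivl open_segment_eq_real_ivl)
  have cont: "continuous_on {a..b} f"
    by (rule DERIV_continuous_on) (rule DERIV_subset[OF assms(7) sub])
  \<comment> \<open>Inside the open interval the derivative relative to \<open>I\<close> is
    two-sided. At \<open>a\<close> and \<open>b\<close>, possibly endpoints of \<open>I\<close>,
    only continuity is used.\<close>
  have der: "(f has_real_derivative f' u) (at u)" if "u \<in> {a<..<b}" for u
  proof -
    have "(f has_real_derivative f' u) (at u within {a<..<b})"
      by (rule DERIV_subset[OF assms(7)]) (use that sub in auto)
    then show ?thesis by (simp only: at_within_open[OF that open_greaterThanLessThan])
  qed
  have cont': "continuous_on (closed_segment c x) f" if "c \<in> {a, b}" for c
    using continuous_on_subset[OF cont seg(1)[OF that]] .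
  have der': "(f has_real_derivative f' u) (at u)" if "c \<in> {a, b}" "u \<in> open_segment c x" for c u
    using der seg(2)[OF that(1)] that(2) by blast
  have int': "f' absolutely_integrable_on closed_segment c x" if "c \<in> {a, b}" for c
    using set_integrable_subset[OF assms(8) _ seg(1)[OF that]] by (simp add: compact_imp_closed)
  have xab: "a \<le> x" "x \<le> b" using x by auto
  have ab: "a \<in> {a, b}" "b \<in> {a, b}" by auto
  note L = RL_left_harm_path[OF pos(1) xab(1) \<alpha> cont'[OF ab(1)] der'[OF ab(1)] int'[OF ab(1)]]
  note R = RL_right_harm_path[OF pos(2) xab(2) \<alpha> cont'[OF ab(2)] der'[OF ab(2)] int'[OF ab(2)]]
  \<comment> \<open>Splits \<open>S_frac\<close> into the part of \<open>a\<close> with its left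
    integral \<open>l\<close> and the part of \<open>b\<close> with its right integral
    \<open>r\<close>.\<close>
  have add: "(p + q) * v - G * (r + l) = X - Y" if "p * v - G * l = X" "q * v - G * r = - Y"
    for p q v G r l X Y :: real
    using that by (simp add: algebra_simps)
  show "S_frac f (\<lambda>u. 1 / u) \<alpha> x a b =
      (x - a) powr (\<alpha> + 1) / (a * x) powr (\<alpha> - 1) *
        (LINT t:{0..1}|lebesgue.
           t powr \<alpha> / (t * a + (1 - t) * x)\<^sup>2 * f' (a * x / (t * a + (1 - t) * x)))
      - (b - x) powr (\<alpha> + 1) / (b * x) powr (\<alpha> - 1) *
        (LINT t:{0..1}|lebesgue.
           t powr \<alpha> / (t * b + (1 - t) * x)\<^sup>2 * f' (b * x / (t * b + (1 - t) * x)))"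
    unfolding S_frac_def by (rule add[OF L[unfolded harm_path_def] R[unfolded harm_path_def]])
qed

end
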